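(* Let $\lambda>0$, $n\ge1$, and let $D_1^*,D_2^*,\dots,D_n^*$ be independent $1/2$-stable subordinators, each with Laplace transform $\mathbb{E}[e^{-sD_i^*(t)}]=e^{-ts^{1/2}}$, $s\ge0$. Let $N$ be a Poisson process with rate $\lambda$ independent of $D_1^*,\dots,D_n^*$. For the iterated composition $D_*^{(n)}(t)=D_1^*\circ D_2^*\circ\cdots\circ D_n^*(t)$, let $\tilde p_k(t)=\mathbb{P}(N(D_*^{(n)}(t))=k)$ for integers $k\ge0$ and $\tilde p_{-1}\equiv0$. Then for every $k\ge0$ and $t>0$, $$\frac{d^{2^n}}{dt^{2^n}}\tilde p_k(t)=\lambda\,[\tilde p_k(t)-\tilde p_{k-1}(t)].$$
   Context: Each $D_i^*$ is a copy of $D^*(t)=\inf\{s\ge0:\ B(s)>t/\sqrt2\}$, with $B$ a standard Brownian motion, which is a stable subordinator of index $1/2$ with Laplace exponent $s^{1/2}$. The Poisson process has $\mathbb{P}(N(x)=k)=e^{-\lambda x}(\lambda x)^k/k!$. *)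

theory Defs
  imports "HOL-Probability.Probability"
begin

text \<open>Processes are functions \<open>X :: real \<Rightarrow> 'a \<Rightarrow> _\<close> of time and outcome; only the times \<open>t \<ge> 0\<close>
  are ever constrained. Path properties are required almost surely.\<close>

definition independent_increments :: "'a measure \<Rightarrow> (real \<Rightarrow> 'a \<Rightarrow> real) \<Rightarrow> bool" where
  "independent_increments M X \<longleftrightarrow>
    (\<forall>(m::nat) (t :: nat \<Rightarrow> real). 0 \<le> t 0 \<and> (\<forall>k<m. t k \<le> t (Suc k)) \<longrightarrow>
      prob_space.indep_vars M (\<lambda>_. borel) (\<lambda>k \<omega>. X (t (Suc k)) \<omega> - X (t k) \<omega>) {..<m})"

definition stationary_increments :: "'a measure \<Rightarrow> (real \<Rightarrow> 'a \<Rightarrow> real) \<Rightarrow> bool" where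
  "stationary_increments M X \<longleftrightarrow>
    (\<forall>s\<ge>0. \<forall>t\<ge>0. distr M borel (\<lambda>\<omega>. X (s + t) \<omega> - X s \<omega>)
                  = distr M borel (\<lambda>\<omega>. X t \<omega> - X 0 \<omega>))"

definition cadlag_path :: "(real \<Rightarrow> real) \<Rightarrow> bool" where
  "cadlag_path x \<longleftrightarrow>
    (\<forall>t\<ge>0. (x \<longlongrightarrow> x t) (at_right t)) \<and> (\<forall>t>0. \<exists>l. (x \<longlongrightarrow> l) (at_left t))"

definition levy_process :: "'a measure \<Rightarrow> (real \<Rightarrow> 'a \<Rightarrow> real) \<Rightarrow> bool" where
  "levy_process M X \<longleftrightarrow>
    (\<forall>t\<ge>0. X t \<in> borel_measurable M) \<and>
    (AE \<omega> in M. X 0 \<omega> = 0) \<and>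
    independent_increments M X \<and>
    stationary_increments M X \<and>
    (AE \<omega> in M. cadlag_path (\<lambda>t. X t \<omega>))"

definition subordinator :: "'a measure \<Rightarrow> (real \<Rightarrow> 'a \<Rightarrow> real) \<Rightarrow> bool" where
  "subordinator M X \<longleftrightarrow> levy_process M X \<and> (AE \<omega> in M. mono_on {0..} (\<lambda>t. X t \<omega>))"

definition stable_subordinator :: "'a measure \<Rightarrow> real \<Rightarrow> (real \<Rightarrow> 'a \<Rightarrow> real) \<Rightarrow> bool" where
  "stable_subordinator M \<alpha> X \<longleftrightarrow>
    0 < \<alpha> \<and> \<alpha> < 1 \<and> subordinator M X \<and>
    (\<exists>c>0. \<forall>s\<ge>0. \<forall>t\<ge>0.
      prob_space.expectation M (\<lambda>\<omega>. exp (- s * X t \<omega>)) = exp (- c * t * s powr \<alpha>))"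

definition poisson_process :: "'a measure \<Rightarrow> real \<Rightarrow> (real \<Rightarrow> 'a \<Rightarrow> nat) \<Rightarrow> bool" where
  "poisson_process M lam N \<longleftrightarrow>
    0 < lam \<and> levy_process M (\<lambda>t \<omega>. real (N t \<omega>)) \<and>
    (\<forall>t\<ge>0. \<forall>k. measure M {\<omega> \<in> space M. N t \<omega> = k} = exp (- lam * t) * (lam * t) ^ k / fact k)"

text \<open>The \<open>\<sigma>\<close>-algebra \<open>\<sigma>(X\<^sub>i : i \<in> I)\<close> on the sample space; independence of whole processes is
  independence of these \<open>\<sigma>\<close>-algebras.\<close>

definition generated_events ::
    "'a measure \<Rightarrow> 'i set \<Rightarrow> ('i \<Rightarrow> 'a \<Rightarrow> 'b::topological_space) \<Rightarrow> 'a set set" where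
  "generated_events M I X =
    sigma_sets (space M) {X i -` A \<inter> space M | i A. i \<in> I \<and> A \<in> sets borel}"

definition independent_processes :: "'a measure \<Rightarrow> nat set \<Rightarrow> (nat \<Rightarrow> real \<Rightarrow> 'a \<Rightarrow> real) \<Rightarrow> bool" where
  "independent_processes M J D \<longleftrightarrow>
    prob_space.indep_sets M (\<lambda>i. generated_events M {0..} (D i)) J"

text \<open>\<open>N\<close> is independent of the whole family \<open>(D\<^sub>j)\<^bsub>j \<in> J\<^esub>\<close> jointly, not merely of each member.\<close>

definition independent_of_processes ::
    "'a measure \<Rightarrow> (real \<Rightarrow> 'a \<Rightarrow> nat) \<Rightarrow> nat set \<Rightarrow> (nat \<Rightarrow> real \<Rightarrow> 'a \<Rightarrow> real) \<Rightarrow> bool" where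
  "independent_of_processes M N J D \<longleftrightarrow>
    prob_space.indep_set M (generated_events M {0..} N)
      (generated_events M (J \<times> {0..}) (\<lambda>(j, t). D j t))"

text \<open>\<open>iterated_composition D n t = D\<^sub>1 (D\<^sub>2 (\<dots> (D\<^sub>n t)))\<close>, outcome by outcome.\<close>

primrec iterated_composition :: "(nat \<Rightarrow> real \<Rightarrow> 'a \<Rightarrow> real) \<Rightarrow> nat \<Rightarrow> real \<Rightarrow> 'a \<Rightarrow> real" where
  "iterated_composition D 0 t \<omega> = t"
| "iterated_composition D (Suc n) t \<omega> = iterated_composition D n (D (Suc n) t \<omega>) \<omega>"

text \<open>Since paths are regular only almost surely, the event \<open>N(D\<^sub>1 (\<dots> (D\<^sub>n t))) = k\<close> is determined
  only up to a null set and need not lie in \<open>sets M\<close>, hence the completion; on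
  \<open>sets M\<close> the two measures agree. The index \<open>k\<close> is an integer so that \<open>k = -1\<close> is available.\<close>

definition p_tilde :: "'a measure \<Rightarrow> (real \<Rightarrow> 'a \<Rightarrow> nat) \<Rightarrow> (nat \<Rightarrow> real \<Rightarrow> 'a \<Rightarrow> real) \<Rightarrow> nat
    \<Rightarrow> int \<Rightarrow> real \<Rightarrow> real" where
  "p_tilde M N D n k t =
    (if k < 0 then 0
     else measure (completion M)
            {\<omega> \<in> space M. N (iterated_composition D n t \<omega>) \<omega> = nat k})"

end

theory Submission
  imports Defs
begin

text \<open>Let \<open>\<alpha> = 2\<^sup>-\<^sup>n\<close> and \<open>V = D\<^sub>1 (\<dots> (D\<^sub>n t))\<close>. Approximating the inner time from the right by
  countably valued times and conditioning gives \<open>E exp (- s V) = exp (- t s\<^sup>\<alpha>)\<close> by induction, and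
  \<open>P(N(V) = k) = E (exp (- \<lambda> V) (\<lambda> V)\<^sup>k / k!)\<close>. Summing over \<open>k\<close>, the generating function of
  \<open>p\<^sub>k(t)\<close> is \<open>exp (- t a(u))\<close> with \<open>a(u) = \<lambda>\<^sup>\<alpha> (1 - u)\<^sup>\<alpha>\<close>. Hence \<open>d/dt\<close> acts on the coefficients as
  multiplication by the power series \<open>- a\<close>, and the \<open>2\<^sup>n\<close>-fold application is multiplication by
  \<open>a\<^bsup>2^n\<^esup> = \<lambda> (1 - u)\<close>.\<close>

section \<open>Power series whose logarithm is linear in a parameter\<close>

lemma has_fps_expansion_at_0:
  fixes F :: "'a :: {banach, real_normed_field} fps"
  assumes "f has_fps_expansion F"
  shows "f 0 = fps_nth F 0"
  using assms eventually_nhds_x_imp_x[of "\<lambda>z. eval_fps F z = f z" 0]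
  by (auto simp: has_fps_expansion_def eval_fps_at_0)

text \<open>If the difference \<open>H\<close> had a leading coefficient
  \<open>c \<noteq> 0\<close>, dividing the zero function by the leading power would give a function
  that is 0 off the origin, has value \<open>c\<close> there, and is continuous. This uniqueness
  turns identities of functions near 0 into identities of series.\<close>

lemma has_fps_expansion_unique:
  fixes F G :: "'a :: {banach, real_normed_field} fps"
  assumes "f has_fps_expansion F" "f has_fps_expansion G"
  shows "F = G"
proof (rule ccontr)
  assume neq: "F \<noteq> G"
  define H where "H = F - G"
  define c where "c = fps_nth H (subdegree H)"
  have "c \<noteq> 0"
    unfolding c_def by (rule nth_subdegree_nonzero) (use neq in \<open>simp add: H_def\<close>)
  have "(\<lambda>_. 0) has_fps_expansion H"
    using has_fps_expansion_diff[OF assms] by (simp add: H_def)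
  then have "(\<lambda>x. if x = 0 then c else 0 / x ^ subdegree H) has_fps_expansion fps_shift (subdegree H) H"
    by (rule has_fps_expansion_shift) (simp_all add: c_def)
  then have "continuous (at 0) (\<lambda>x. if x = 0 then c else 0 / x ^ subdegree H)"
    by (rule has_fps_expansion_imp_continuous)
  then have "((\<lambda>x :: 'a. if x = 0 then c else 0 / x ^ subdegree H) \<longlongrightarrow> c) (at 0)"
    by (simp add: continuous_at)
  moreover have "((\<lambda>x :: 'a. if x = 0 then c else 0 / x ^ subdegree H) \<longlongrightarrow> 0) (at 0)"
    by (rule tendsto_eventually) (simp add: eventually_at_filter)
  ultimately show False
    using \<open>c \<noteq> 0\<close> tendsto_unique[OF trivial_limit_at] by blast
qed

text \<open>Near 0 the function agrees with its series on a whole neighbourhood of each point, so it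
  inherits the derivative of the series. It guarantees that \<open>deriv a\<close> is a genuine
  derivative when the chain rule is applied below.\<close>

lemma has_fps_expansion_imp_eventually_differentiable:
  fixes F :: "'a :: {banach, real_normed_field} fps"
  assumes "f has_fps_expansion F"
  shows "\<forall>\<^sub>F z in nhds 0. f field_differentiable at z"
proof -
  have "\<forall>\<^sub>F z in nhds 0. z \<in> eball 0 (fps_conv_radius F)"
    using assms by (intro eventually_nhds_in_open)
      (auto simp: has_fps_expansion_def zero_ereal_def)
  moreover have "\<forall>\<^sub>F z in nhds 0. \<forall>\<^sub>F w in nhds z. eval_fps F w = f w"
    using assms by (simp add: has_fps_expansion_def eventually_eventually)
  ultimately show ?thesis
  proof eventually_elim
    case (elim z)
    then have "(eval_fps F has_field_derivative eval_fps (fps_deriv F) z) (at z)"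
      by (intro has_field_derivative_eval_fps) auto
    then have "(f has_field_derivative eval_fps (fps_deriv F) z) (at z)"
      by (rule DERIV_cong_ev[OF refl elim(2) refl, THEN iffD1])
    then show ?case
      by (auto simp: field_differentiable_def)
  qed
qed

text \<open>The binomial series at \<open>- u\<close>, convergent for \<bar>u\<bar> < 1.\<close>

lemma has_fps_expansion_powr_one_minus:
  fixes a c :: real
  shows "(\<lambda>u. c * (1 - u) powr a) has_fps_expansion Abs_fps (\<lambda>n. c * ((a gchoose n) * (- 1) ^ n))"
proof (rule has_fps_expansionI)
  have "\<forall>\<^sub>F u :: real in nhds 0. u \<in> ball 0 1"
    by (intro eventually_nhds_in_open) auto
  then show "\<forall>\<^sub>F u in nhds 0. (\<lambda>n. fps_nth (Abs_fps (\<lambda>n. c * ((a gchoose n) * (- 1) ^ n))) n * u ^ n)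
      sums (c * (1 - u) powr a)"
  proof eventually_elim
    case (elim u)
    then have "(\<lambda>n. (a gchoose n) * (- u) ^ n) sums (1 + - u) powr a"
      by (intro gen_binomial_real) auto
    then have "(\<lambda>n. c * ((a gchoose n) * (- u) ^ n)) sums (c * (1 - u) powr a)"
      by (intro sums_mult) simp
    moreover have "c * ((a gchoose n) * (- u) ^ n) = c * ((a gchoose n) * (- 1) ^ n) * u ^ n" for n
      by (subst power_minus) simp
    ultimately show ?case
      by simp
  qed
qed

text \<open>Differentiating the generating function in \<open>u\<close> expresses \<open>p\<^sub>k\<^sub>+\<^sub>1\<close> by \<open>p\<^sub>0, \<dots>, p\<^sub>k\<close>, so that
  differentiability in \<open>t\<close> follows by induction on \<open>k\<close>, without differentiating a series termwise.\<close>

lemma exponential_family_coeff_derivative: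
  fixes p :: "nat \<Rightarrow> real \<Rightarrow> real" and a :: "real \<Rightarrow> real" and A :: "real fps"
  assumes A: "a has_fps_expansion A"
    and P: "\<And>t. t > 0 \<Longrightarrow> (\<lambda>u. exp (- t * a u)) has_fps_expansion Abs_fps (\<lambda>k. p k t)"
    and "t > 0"
  shows "(p k has_field_derivative fps_nth (- A * Abs_fps (\<lambda>k. p k t)) k) (at t)"
  using \<open>t > 0\<close>
proof (induction k arbitrary: t rule: less_induct)
  case (less k)
  define Q where "Q t = Abs_fps (\<lambda>k. p k t)" for t
  \<comment> \<open>The chain rule in \<open>u\<close> gives \<open>Q' = - t A' Q\<close>, first for
    the functions near 0, then by uniqueness for the formal series.\<close>
  have ode: "fps_deriv (Q t) = - fps_const t * fps_deriv A * Q t" if "t > 0" for t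
  proof (rule has_fps_expansion_unique)
    show "deriv (\<lambda>u. exp (- t * a u)) has_fps_expansion fps_deriv (Q t)"
      using P[OF that] unfolding Q_def by (rule has_fps_expansion_deriv)
    have "(\<lambda>u. - t * deriv a u * exp (- t * a u)) has_fps_expansion (fps_const (- t) * fps_deriv A * Q t)"
      using P[OF that] A unfolding Q_def by (intro fps_expansion_intros)
    moreover have "\<forall>\<^sub>F u in nhds 0. - t * deriv a u * exp (- t * a u) = deriv (\<lambda>u. exp (- t * a u)) u"
      using has_fps_expansion_imp_eventually_differentiable[OF A]
    proof eventually_elim
      case (elim u)
      have "(a has_field_derivative deriv a u) (at u)"
        using elim by (simp add: field_differentiable_derivI)
      then have "((\<lambda>u. exp (- t * a u)) has_field_derivative - t * deriv a u * exp (- t * a u)) (at u)"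
        by (auto intro!: derivative_eq_intros)
      then show ?case
        by (simp add: DERIV_imp_deriv)
    qed
    ultimately show "deriv (\<lambda>u. exp (- t * a u)) has_fps_expansion - fps_const t * fps_deriv A * Q t"
      unfolding has_fps_expansion_def by (auto simp flip: fps_const_neg elim: eventually_elim2)
  qed
  show ?case
  proof (cases k)
    case 0
    \<comment> \<open>The constant term is the generating function at \<open>u = 0\<close>, an
      explicit exponential in \<open>s\<close>.\<close>
    have "p 0 s = exp (- s * a 0)" if "s > 0" for s
      using has_fps_expansion_at_0[OF P[OF that]] by simp
    then have ev: "\<forall>\<^sub>F s in nhds t. exp (- s * a 0) = p 0 s"
      using eventually_nhds_in_open[of "{0<..}" t] less.prems
      by (auto elim!: eventually_mono)
    have "((\<lambda>s. exp (- s * a 0)) has_field_derivative - a 0 * exp (- t * a 0)) (at t)"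
      by (auto intro!: derivative_eq_intros)
    then have "(p 0 has_field_derivative - a 0 * exp (- t * a 0)) (at t)"
      by (rule DERIV_cong_ev[OF refl ev refl, THEN iffD1])
    moreover have "a 0 = fps_nth A 0" "p 0 t = exp (- t * a 0)"
      using has_fps_expansion_at_0[OF A]
        has_fps_expansion_at_0[OF P[OF less.prems]] by simp_all
    ultimately show ?thesis
      using 0 by simp
  next
    case (Suc j)
    define B where "B = - fps_deriv A"
    \<comment> \<open>Coefficient \<open>j\<close> of the differential equation in \<open>u\<close>,
      divided by \<open>j + 1\<close>: a finite sum involving only the indices up to
      \<open>j\<close>, to which the induction hypothesis applies.\<close>
    have rec: "p (Suc j) s = s * (\<Sum>i=0..j. fps_nth B i * p (j - i) s) / (real j + 1)" if "s > 0" for s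
    proof -
      have "fps_deriv (Q s) = fps_const s * (B * Q s)"
        unfolding ode[OF that] by (simp add: B_def mult.assoc flip: fps_const_neg)
      then have "fps_nth (fps_deriv (Q s)) j = s * fps_nth (B * Q s) j"
        by (simp only: fps_mult_left_const_nth)
      then have "(real j + 1) * p (Suc j) s = s * (\<Sum>i=0..j. fps_nth B i * p (j - i) s)"
        by (simp add: Q_def fps_mult_nth[of B] algebra_simps)
      then show ?thesis
        by (simp add: field_simps)
    qed
    have ev: "\<forall>\<^sub>F s in nhds t. s * (\<Sum>i=0..j. fps_nth B i * p (j - i) s) / (real j + 1) = p (Suc j) s"
      using eventually_nhds_in_open[of "{0<..}" t] less.prems rec
      by (auto elim!: eventually_mono)
    have "((\<lambda>s. s * (\<Sum>i=0..j. fps_nth B i * p (j - i) s) / (real j + 1)) has_field_derivative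
       ((\<Sum>i=0..j. fps_nth B i * p (j - i) t) + t * (\<Sum>i=0..j. fps_nth B i * fps_nth (- A * Q t) (j - i)))
         / (real j + 1)) (at t)"
    proof -
      have "(p (j - i) has_field_derivative fps_nth (- A * Q t) (j - i)) (at t)" for i
        using less.IH[of "j - i" t] less.prems Suc by (simp add: Q_def)
      then have "((\<lambda>s. \<Sum>i=0..j. fps_nth B i * p (j - i) s) has_field_derivative
          (\<Sum>i=0..j. fps_nth B i * fps_nth (- A * Q t) (j - i))) (at t)"
        by (intro DERIV_sum DERIV_cmult)
      from DERIV_cdivide[OF DERIV_mult[OF DERIV_ident this], of "real j + 1"] show ?thesis
        by (simp add: algebra_simps)
    qed
    also have "(\<Sum>i=0..j. fps_nth B i * p (j - i) t) + t * (\<Sum>i=0..j. fps_nth B i * fps_nth (- A * Q t) (j - i))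
        = fps_nth (B * Q t + fps_const t * (B * (- A * Q t))) j"
      unfolding fps_add_nth fps_mult_left_const_nth fps_mult_nth[of B] by (simp add: Q_def)
    \<comment> \<open>Product rule: \<open>(- A Q)' = - A' Q - A Q'\<close>, with
      \<open>- A' = B\<close> and \<open>Q' = t B Q\<close>. Its coefficient \<open>j\<close> is
      \<open>j + 1\<close> times coefficient \<open>k = Suc j\<close> of \<open>- A Q\<close>, which
      cancels the denominator.\<close>
    also have "B * Q t + fps_const t * (B * (- A * Q t)) = fps_deriv (- A * Q t)"
      using ode[OF less.prems] by (simp add: B_def algebra_simps del: fps_const_neg)
    also have "fps_nth (fps_deriv (- A * Q t)) j / (real j + 1) = fps_nth (- A * Q t) k"
      using Suc by (simp add: field_simps del: fps_deriv_mult)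
    finally show ?thesis
      unfolding Q_def Suc by (rule DERIV_cong_ev[OF refl ev refl, THEN iffD1])
  qed
qed

text \<open>For a series \<open>C\<close> free of \<open>t\<close>, each coefficient of
  \<open>C * Q t\<close> is a finite linear combination of the \<open>p i t\<close>, so
  differentiating it inserts one more factor \<open>- A\<close>. The value formula is proved on all
  of \<open>t > 0\<close> together with differentiability, since the next derivative needs it in a
  neighbourhood.\<close>

lemma exponential_family_coeff_iterated_deriv:
  fixes p :: "nat \<Rightarrow> real \<Rightarrow> real" and a :: "real \<Rightarrow> real" and A :: "real fps"
  assumes A: "a has_fps_expansion A"
    and P: "\<And>t. t > 0 \<Longrightarrow> (\<lambda>u. exp (- t * a u)) has_fps_expansion Abs_fps (\<lambda>k. p k t)"
    and "t > 0"
  shows "(deriv ^^ m) (p k) t = fps_nth ((- A) ^ m * Abs_fps (\<lambda>k. p k t)) k"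
    and "((deriv ^^ m) (p k) has_field_derivative fps_nth ((- A) ^ Suc m * Abs_fps (\<lambda>k. p k t)) k) (at t)"
proof -
  define Q where "Q t = Abs_fps (\<lambda>k. p k t)" for t
  have D: "((\<lambda>t. fps_nth (C * Q t) k) has_field_derivative fps_nth (C * - A * Q t) k) (at t)"
    if "t > 0" for t and C :: "real fps"
  proof -
    have "((\<lambda>t. \<Sum>i=0..k. fps_nth C i * p (k - i) t) has_field_derivative
        (\<Sum>i=0..k. fps_nth C i * fps_nth (- A * Q t) (k - i))) (at t)"
      using exponential_family_coeff_derivative[OF A P that] unfolding Q_def
      by (intro DERIV_sum DERIV_cmult)
    then show ?thesis
      by (simp add: fps_mult_nth[of C] Q_def mult.assoc sum_negf)
  qed
  have "\<forall>t>0. (deriv ^^ m) (p k) t = fps_nth ((- A) ^ m * Q t) k \<and>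
    ((deriv ^^ m) (p k) has_field_derivative fps_nth ((- A) ^ Suc m * Q t) k) (at t)"
  proof (induction m)
    case 0
    then show ?case
      using exponential_family_coeff_derivative[OF A P] by (simp add: Q_def)
  next
    case (Suc m)
    then have eq: "(deriv ^^ Suc m) (p k) t = fps_nth ((- A) ^ Suc m * Q t) k" if "t > 0" for t
      using that by (auto intro: DERIV_imp_deriv)
    moreover have "((deriv ^^ Suc m) (p k) has_field_derivative fps_nth ((- A) ^ Suc (Suc m) * Q t) k) (at t)"
      if "t > 0" for t
    proof -
      have ev: "\<forall>\<^sub>F s in nhds t. fps_nth ((- A) ^ Suc m * Q s) k = (deriv ^^ Suc m) (p k) s"
        using eventually_nhds_in_open[of "{0<..}" t] that eq
        by (auto elim!: eventually_mono simp del: power_Suc funpow.simps)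
      have "((\<lambda>s. fps_nth ((- A) ^ Suc m * Q s) k) has_field_derivative
          fps_nth ((- A) ^ Suc (Suc m) * Q t) k) (at t)"
        using D[OF that, of "(- A) ^ Suc m"] by (simp only: power_Suc2)
      then show ?thesis
        by (rule DERIV_cong_ev[OF refl ev refl, THEN iffD1])
    qed
    ultimately show ?case
      by blast
  qed
  then show "(deriv ^^ m) (p k) t = fps_nth ((- A) ^ m * Abs_fps (\<lambda>k. p k t)) k"
    and "((deriv ^^ m) (p k) has_field_derivative fps_nth ((- A) ^ Suc m * Abs_fps (\<lambda>k. p k t)) k) (at t)"
    using \<open>t > 0\<close> by (auto simp: Q_def)
qed

section \<open>Processes evaluated at independent random times\<close>

text \<open>For \<open>y \<ge> 0\<close> this is the least multiple of \<open>1 / (m + 1)\<close>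
  strictly above \<open>y\<close>. The added 1 makes the approximation strict, as limits along
  \<open>at_right y\<close> require.\<close>

definition upper_approx :: "nat \<Rightarrow> real \<Rightarrow> real" where
  "upper_approx m y = (real (nat \<lfloor>(real m + 1) * y\<rfloor>) + 1) / (real m + 1)"

lemma upper_approx_greater: "y < upper_approx m y"
proof -
  have "(real m + 1) * y < real (nat \<lfloor>(real m + 1) * y\<rfloor>) + 1"
    by linarith
  then show ?thesis
    by (simp add: upper_approx_def field_simps)
qed

lemma upper_approx_le:
  assumes "0 \<le> y"
  shows "upper_approx m y \<le> y + 1 / (real m + 1)"
proof -
  have "0 \<le> (real m + 1) * y"
    using assms by simp
  then have "real (nat \<lfloor>(real m + 1) * y\<rfloor>) + 1 \<le> (real m + 1) * y + 1"
    by linarith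
  then have "upper_approx m y \<le> ((real m + 1) * y + 1) / (real m + 1)"
    unfolding upper_approx_def by (intro divide_right_mono) auto
  also have "\<dots> = y + 1 / (real m + 1)"
    by (simp add: field_simps)
  finally show ?thesis .
qed

lemma tendsto_upper_approx:
  assumes "0 \<le> y"
  shows "(\<lambda>m. upper_approx m y) \<longlonglongrightarrow> y"
proof (rule real_tendsto_sandwich[where f = "\<lambda>_. y" and h = "\<lambda>m. y + 1 / (real m + 1)"])
  have "(\<lambda>m. 1 / (real m + 1)) \<longlonglongrightarrow> 0"
    using LIMSEQ_inverse_real_of_nat by (simp add: inverse_eq_divide add.commute)
  then show "(\<lambda>m. y + 1 / (real m + 1)) \<longlonglongrightarrow> y"
    using tendsto_add[OF tendsto_const[of y]] by fastforce
qed (use assms in \<open>auto simp: upper_approx_le upper_approx_greater[THEN less_imp_le]\<close>)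

lemma filterlim_upper_approx:
  assumes "0 \<le> y"
  shows "filterlim (\<lambda>m. upper_approx m y) (at_right y) sequentially"
  unfolding filterlim_at using assms upper_approx_greater[of y]
  by (auto simp: tendsto_upper_approx intro!: always_eventually less_imp_neq[symmetric])

lemma measurable_upper_approx [measurable]: "upper_approx m \<in> borel_measurable borel"
  unfolding upper_approx_def by measurable

text \<open>The grid has countably many points, so the composition is patched together from random
  variables \<open>Z u\<close> at fixed times.\<close>

lemma measurable_process_upper_approx:
  assumes [measurable]: "Y \<in> borel_measurable M"
    and Z: "\<And>u. 0 \<le> u \<Longrightarrow> Z u \<in> borel_measurable M"
  shows "(\<lambda>\<omega>. Z (upper_approx m (Y \<omega>)) \<omega>) \<in> borel_measurable M"
  unfolding upper_approx_def
  by (rule measurable_compose_countable[where f = "\<lambda>i \<omega>. Z ((real i + 1) / (real m + 1)) \<omega>"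
        and g = "\<lambda>\<omega>. nat \<lfloor>(real m + 1) * Y \<omega>\<rfloor>"]) (auto intro: Z)

context prob_space
begin

text \<open>On each event \<open>K = j\<close> the index is frozen and independence factors the
  expectation. The sum over \<open>j < m\<close> then tends to the full expectation by dominated
  convergence. In the right-hand side the inner expectation is taken with \<open>K \<omega>\<close>
  held fixed.\<close>

lemma expectation_random_index:
  fixes X :: "nat \<Rightarrow> 'a \<Rightarrow> real"
  assumes X [measurable]: "\<And>j. X j \<in> borel_measurable M"
    and bound: "\<And>j \<omega>. \<bar>X j \<omega>\<bar> \<le> C"
    and K [measurable]: "K \<in> measurable M (count_space UNIV)"
    and indep: "\<And>j. indep_var borel (X j) borel (\<lambda>\<omega>. real (K \<omega>))"
  shows "expectation (\<lambda>\<omega>. X (K \<omega>) \<omega>) = expectation (\<lambda>\<omega>. expectation (X (K \<omega>)))"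
proof -
  have C: "0 \<le> C"
    using bound[of 0 undefined] by linarith
  have intX: "integrable M (X j)" for j
    using bound by (intro integrable_const_bound[of _ C]) auto
  have EX: "\<bar>expectation (X j)\<bar> \<le> C" for j
  proof -
    have "\<bar>expectation (X j)\<bar> \<le> expectation (\<lambda>\<omega>. \<bar>X j \<omega>\<bar>)"
      by simp
    also have "\<dots> \<le> C"
      using intX bound by (intro integral_le_const) auto
    finally show ?thesis .
  qed
  have lim: "(\<lambda>m. expectation (\<lambda>\<omega>. \<Sum>j<m. F j \<omega> * indicator {j} (K \<omega>)))
      \<longlonglongrightarrow> expectation (\<lambda>\<omega>. F (K \<omega>) \<omega>)"
    if F [measurable]: "\<And>j. F j \<in> borel_measurable M" and F_bound: "\<And>j \<omega>. \<bar>F j \<omega>\<bar> \<le> C"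
    for F :: "nat \<Rightarrow> 'a \<Rightarrow> real"
  proof (rule integral_dominated_convergence[where w = "\<lambda>_. C"])
    \<comment> \<open>At each outcome at most one summand survives, so the partial sums are
      eventually constant and bounded by \<open>C\<close>.\<close>
    have eq: "(\<Sum>j<m. F j \<omega> * indicator {j} (K \<omega>)) = (if K \<omega> < m then F (K \<omega>) \<omega> else 0)" for m \<omega>
      by (simp add: indicator_def if_distrib sum.delta' cong: if_cong)
    show "AE \<omega> in M. (\<lambda>m. \<Sum>j<m. F j \<omega> * indicator {j} (K \<omega>)) \<longlonglongrightarrow> F (K \<omega>) \<omega>"
    proof (rule AE_I2)
      fix \<omega>
      have "\<forall>\<^sub>F m in sequentially. F (K \<omega>) \<omega> = (\<Sum>j<m. F j \<omega> * indicator {j} (K \<omega>))"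
        using eventually_gt_at_top[of "K \<omega>"] unfolding eq by eventually_elim simp
      then show "(\<lambda>m. \<Sum>j<m. F j \<omega> * indicator {j} (K \<omega>)) \<longlonglongrightarrow> F (K \<omega>) \<omega>"
        by (rule Lim_transform_eventually[OF tendsto_const])
    qed
    show "AE \<omega> in M. norm (\<Sum>j<m. F j \<omega> * indicator {j} (K \<omega>)) \<le> C" for m
      using F_bound C unfolding eq by (intro AE_I2) simp
    show "(\<lambda>\<omega>. F (K \<omega>) \<omega>) \<in> borel_measurable M"
      by (rule measurable_compose_countable[OF F K])
  qed simp_all
  have "expectation (\<lambda>\<omega>. \<Sum>j<m. X j \<omega> * indicator {j} (K \<omega>))
      = expectation (\<lambda>\<omega>. \<Sum>j<m. expectation (X j) * indicator {j} (K \<omega>))" for m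
  proof -
    have int: "integrable M (\<lambda>\<omega>. indicator {j} (K \<omega>) :: real)" for j
      by (intro integrable_const_bound[of _ 1]) (auto simp: indicator_def)
    have prod: "integrable M (\<lambda>\<omega>. X j \<omega> * indicator {j} (K \<omega>))" 
      "expectation (\<lambda>\<omega>. X j \<omega> * indicator {j} (K \<omega>))
        = expectation (X j) * expectation (\<lambda>\<omega>. indicator {j} (K \<omega>))" for j
    proof -
      have "indep_var borel ((\<lambda>x. x) \<circ> X j) borel (indicator {real j} \<circ> (\<lambda>\<omega>. real (K \<omega>)))"
        by (rule indep_var_compose[OF indep]) auto
      then have ind: "indep_var borel (X j) borel (\<lambda>\<omega>. indicator {j} (K \<omega>) :: real)"
        by (simp add: comp_def indicator_def)
      show "integrable M (\<lambda>\<omega>. X j \<omega> * indicator {j} (K \<omega>))"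
        by (rule indep_var_integrable[OF ind intX int])
      show "expectation (\<lambda>\<omega>. X j \<omega> * indicator {j} (K \<omega>))
        = expectation (X j) * expectation (\<lambda>\<omega>. indicator {j} (K \<omega>))"
        by (rule indep_var_lebesgue_integral[OF ind intX int])
    qed
    show ?thesis
      using prod int by (simp add: Bochner_Integration.integral_sum del: sum_mult_indicator)
  qed
  then have "(\<lambda>m. expectation (\<lambda>\<omega>. \<Sum>j<m. X j \<omega> * indicator {j} (K \<omega>)))
      \<longlonglongrightarrow> expectation (\<lambda>\<omega>. expectation (X (K \<omega>)))"
    using lim[of "\<lambda>j _. expectation (X j)"] EX by simp
  then show ?thesis
    using lim[of X, OF X bound] LIMSEQ_unique by blast
qed

text \<open>Replace \<open>Y\<close> by its grid approximation, where conditioning on countably many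
  values turns \<open>g (Z u)\<close> into its mean \<open>h u\<close>, and let the mesh tend to 0
  on both sides. Continuity and boundedness of \<open>g\<close> and \<open>h\<close> justify the
  limits. \<open>W\<close> is a measurable stand-in for \<open>Z\<close> at time \<open>Y\<close>,
  which itself may fail to be measurable.\<close>

lemma expectation_process_at_independent_time:
  fixes Z :: "real \<Rightarrow> 'a \<Rightarrow> real" and g h :: "real \<Rightarrow> real"
  assumes Y_nonneg: "\<And>\<omega>. 0 \<le> Y \<omega>"
    and indep: "\<And>u. 0 \<le> u \<Longrightarrow> indep_var borel (Z u) borel Y"
    and W [measurable]: "W \<in> borel_measurable M"
    and lim: "AE \<omega> in M. (\<lambda>m. Z (upper_approx m (Y \<omega>)) \<omega>) \<longlonglongrightarrow> W \<omega>"
    and g: "continuous_on UNIV g" "\<And>x. \<bar>g x\<bar> \<le> C"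
    and h: "continuous_on {0..} h" "\<And>u. 0 \<le> u \<Longrightarrow> h u = expectation (\<lambda>\<omega>. g (Z u \<omega>))"
  shows "expectation (\<lambda>\<omega>. g (W \<omega>)) = expectation (\<lambda>\<omega>. h (Y \<omega>))"
proof -
  have Y [measurable]: "Y \<in> borel_measurable M"
    using indep_var_rv2[OF indep[of 0]] by simp
  have Z: "Z u \<in> borel_measurable M" if "0 \<le> u" for u
    using indep_var_rv1[OF indep[OF that]] .
  have [measurable]: "g \<in> borel_measurable borel"
    using g(1) by (rule borel_measurable_continuous_onI)
  have [measurable]: "(\<lambda>\<omega>. Z (upper_approx m (Y \<omega>)) \<omega>) \<in> borel_measurable M" for m
    by (rule measurable_process_upper_approx[OF Y Z])
  \<comment> \<open>Continuous extension of \<open>h\<close> by the constant \<open>h 0\<close> to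
    negative arguments, which makes it Borel measurable on the whole line.\<close>
  define h' where "h' u = h (max 0 u)" for u
  have "continuous_on UNIV h'"
    unfolding h'_def by (rule continuous_on_compose2[OF h(1)]) (auto intro!: continuous_intros)
  then have [measurable]: "h' \<in> borel_measurable borel"
    by (rule borel_measurable_continuous_onI)
  have ua_nonneg: "0 \<le> upper_approx m (Y \<omega>)" for m \<omega>
    using upper_approx_greater[of "Y \<omega>" m] Y_nonneg[of \<omega>] by linarith
  have h_bound: "\<bar>h u\<bar> \<le> C" if "0 \<le> u" for u
  proof -
    have [measurable]: "Z u \<in> borel_measurable M"
      using Z that .
    have "\<bar>h u\<bar> \<le> expectation (\<lambda>\<omega>. \<bar>g (Z u \<omega>)\<bar>)"
      unfolding h(2)[OF that] by simp
    also have "\<dots> \<le> C"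
      using g(2) by (intro integral_le_const integrable_const_bound[of _ C]) auto
    finally show ?thesis .
  qed
  have step: "expectation (\<lambda>\<omega>. g (Z (upper_approx m (Y \<omega>)) \<omega>)) = expectation (\<lambda>\<omega>. h' (upper_approx m (Y \<omega>)))" for m
  proof -
    \<comment> \<open>\<open>q\<close> enumerates the grid points and \<open>K\<close> is the index
      of the one chosen for \<open>Y\<close>.\<close>
    define q where "q j = (real j + 1) / (real m + 1)" for j
    define K where "K \<omega> = nat \<lfloor>(real m + 1) * Y \<omega>\<rfloor>" for \<omega>
    have q_nonneg: "0 \<le> q j" for j
      by (simp add: q_def)
    have ua: "upper_approx m (Y \<omega>) = q (K \<omega>)" for \<omega>
      by (simp add: upper_approx_def q_def K_def)
    have "expectation (\<lambda>\<omega>. g (Z (q (K \<omega>)) \<omega>)) = expectation (\<lambda>\<omega>. expectation (\<lambda>\<omega>'. g (Z (q (K \<omega>)) \<omega>')))"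
    proof (rule expectation_random_index[of "\<lambda>j \<omega>. g (Z (q j) \<omega>)" C])
      show "(\<lambda>\<omega>. g (Z (q j) \<omega>)) \<in> borel_measurable M" for j
        using Z[OF q_nonneg] by measurable
      show "K \<in> measurable M (count_space UNIV)"
        unfolding K_def[abs_def] by measurable
      have "indep_var borel (g \<circ> Z (q j)) borel ((\<lambda>y. real (nat \<lfloor>(real m + 1) * y\<rfloor>)) \<circ> Y)" for j
        by (rule indep_var_compose[OF indep[OF q_nonneg]]) measurable
      then show "indep_var borel (\<lambda>\<omega>. g (Z (q j) \<omega>)) borel (\<lambda>\<omega>. real (K \<omega>))" for j
        by (simp add: comp_def K_def[abs_def])
    qed (use g(2) in auto)
    also have "\<dots> = expectation (\<lambda>\<omega>. h' (q (K \<omega>)))"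
      using h(2) q_nonneg by (simp add: h'_def)
    finally show ?thesis
      by (simp add: ua)
  qed
  have "(\<lambda>m. expectation (\<lambda>\<omega>. g (Z (upper_approx m (Y \<omega>)) \<omega>))) \<longlonglongrightarrow> expectation (\<lambda>\<omega>. g (W \<omega>))"
  proof (rule integral_dominated_convergence[where w = "\<lambda>_. C"])
    show "AE \<omega> in M. (\<lambda>m. g (Z (upper_approx m (Y \<omega>)) \<omega>)) \<longlonglongrightarrow> g (W \<omega>)"
      using lim
    proof eventually_elim
      case (elim \<omega>)
      have "isCont g (W \<omega>)"
        using g(1) by (simp add: continuous_on_eq_continuous_at)
      then show ?case
        using elim by (rule isCont_tendsto_compose)
    qed
  qed (use g(2) in auto)
  moreover have "(\<lambda>m. expectation (\<lambda>\<omega>. h' (upper_approx m (Y \<omega>)))) \<longlonglongrightarrow> expectation (\<lambda>\<omega>. h' (Y \<omega>))"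
  proof (rule integral_dominated_convergence[where w = "\<lambda>_. C"])
    show "AE \<omega> in M. (\<lambda>m. h' (upper_approx m (Y \<omega>))) \<longlonglongrightarrow> h' (Y \<omega>)"
    proof (rule AE_I2)
      fix \<omega>
      have "isCont h' (Y \<omega>)"
        using \<open>continuous_on UNIV h'\<close> by (simp add: continuous_on_eq_continuous_at)
      then show "(\<lambda>m. h' (upper_approx m (Y \<omega>))) \<longlonglongrightarrow> h' (Y \<omega>)"
        using tendsto_upper_approx[OF Y_nonneg] by (rule isCont_tendsto_compose)
    qed
    show "AE \<omega> in M. norm (h' (upper_approx m (Y \<omega>))) \<le> C" for m
      using h_bound by (simp add: h'_def)
  qed simp_all
  ultimately have "expectation (\<lambda>\<omega>. g (W \<omega>)) = expectation (\<lambda>\<omega>. h' (Y \<omega>))"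
    unfolding step using LIMSEQ_unique by blast
  then show ?thesis
    using Y_nonneg by (simp add: h'_def max_absorb2)
qed

text \<open>The events generated by \<open>X\<close> lie in \<open>A\<close> and those generated by
  \<open>Y\<close> in \<open>B\<close>. This passes from independence of whole processes to that of
  variables built from them.\<close>

lemma indep_varI_subalgebras:
  assumes indep: "indep_set (sets A) (sets B)" and space: "space A = space M" "space B = space M"
    and X: "X \<in> measurable A S" and Y: "Y \<in> measurable B T"
  shows "indep_var S X T Y"
proof -
  have sub: "sets A \<subseteq> events" "sets B \<subseteq> events"
    using indep by (auto simp: indep_set_def indep_sets_def split: bool.splits)
  have "sigma_sets (space M) {X -` E \<inter> space M |E. E \<in> sets S} \<subseteq> sets A"
    using X by (auto simp flip: space(1) intro!: sets.sigma_sets_subset measurable_sets)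
  moreover have "sigma_sets (space M) {Y -` E \<inter> space M |E. E \<in> sets T} \<subseteq> sets B"
    using Y by (auto simp flip: space(2) intro!: sets.sigma_sets_subset measurable_sets)
  ultimately have "indep_set (sigma_sets (space M) {X -` E \<inter> space M |E. E \<in> sets S})
      (sigma_sets (space M) {Y -` E \<inter> space M |E. E \<in> sets T})"
    using indep unfolding indep_set_def by (elim indep_sets_mono_sets) (auto split: bool.splits)
  moreover have "X \<in> measurable M S" "Y \<in> measurable M T"
    using X Y sub space by (auto simp: measurable_def)
  ultimately show ?thesis
    by (simp add: indep_var_eq)
qed

end

lemma measurable_real_nat_borel: "real \<in> borel_measurable (borel :: nat measure)"
  by (intro borel_measurable_continuous_onI continuous_on_of_nat continuous_on_id)

lemma measurable_mono_sets:
  assumes "f \<in> measurable A S" "sets A \<subseteq> sets B" "space A = space B"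
  shows "f \<in> measurable B S"
  using assms(2,3) measurable_sets[OF assms(1)] measurable_space[OF assms(1)]
  by (intro measurableI) auto

section \<open>Poisson mixtures and their generating functions\<close>

lemma poisson_weights_generating_function:
  fixes x u :: real
  shows "(\<lambda>k. exp (- x) * x ^ k / fact k * u ^ k) sums exp (- x * (1 - u))"
proof -
  have "(\<lambda>k. exp (- x) * ((x * u) ^ k /\<^sub>R fact k)) sums (exp (- x) * exp (x * u))"
    by (intro sums_mult exp_converges)
  moreover have "exp (- x) * ((x * u) ^ k /\<^sub>R fact k) = exp (- x) * x ^ k / fact k * u ^ k" for k
    by (simp add: power_mult_distrib divide_inverse)
  ultimately show ?thesis
    by (simp add: algebra_simps flip: exp_add)
qed

text \<open>Sum and expectation are exchanged by dominated convergence: for \<bar>u\<bar> < 1 the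
  partial sums are bounded by the total Poisson mass 1, which is the weight identity at
  \<open>u = 1\<close>.\<close>

lemma (in prob_space) mixed_poisson_generating_function:
  fixes X :: "'a \<Rightarrow> real" and u :: real
  assumes [measurable]: "X \<in> borel_measurable M" and nonneg: "\<And>\<omega>. 0 \<le> X \<omega>" and u: "\<bar>u\<bar> < 1"
  shows "(\<lambda>k. expectation (\<lambda>\<omega>. exp (- X \<omega>) * X \<omega> ^ k / fact k) * u ^ k)
    sums expectation (\<lambda>\<omega>. exp (- X \<omega> * (1 - u)))"
proof -
  define w where "w k \<omega> = exp (- X \<omega>) * X \<omega> ^ k / fact k" for k \<omega>
  have w_nonneg: "0 \<le> w k \<omega>" for k \<omega>
    using nonneg by (simp add: w_def)
  have partial_sums: "(\<Sum>k<m. \<bar>w k \<omega> * u ^ k\<bar>) \<le> 1" for m \<omega>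
  proof -
    have sums: "(\<lambda>k. w k \<omega>) sums 1"
      using poisson_weights_generating_function[of "X \<omega>" 1] by (simp add: w_def)
    have "\<bar>w k \<omega> * u ^ k\<bar> \<le> w k \<omega>" for k
      using w_nonneg u by (simp add: abs_mult power_abs mult_left_le power_le_one)
    then have "(\<Sum>k<m. \<bar>w k \<omega> * u ^ k\<bar>) \<le> (\<Sum>k<m. w k \<omega>)"
      by (intro sum_mono)
    also have "\<dots> \<le> 1"
      using sum_le_suminf[OF sums_summable[OF sums], of "{..<m}"] w_nonneg sums by (simp add: sums_iff)
    finally show ?thesis .
  qed
  have w_meas [measurable]: "w k \<in> borel_measurable M" for k
    unfolding w_def by measurable
  have int: "integrable M (w k)" for k
  proof (rule integrable_const_bound[of _ 1])
    show "AE \<omega> in M. norm (w k \<omega>) \<le> 1"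
    proof (rule AE_I2)
      fix \<omega>
      have "(\<Sum>j\<in>{k}. w j \<omega>) \<le> suminf (\<lambda>j. w j \<omega>)"
        using poisson_weights_generating_function[of "X \<omega>" 1] w_nonneg
        by (intro sum_le_suminf) (auto simp: w_def sums_iff)
      also have "\<dots> = 1"
        using poisson_weights_generating_function[of "X \<omega>" 1] by (simp add: w_def sums_iff)
      finally show "norm (w k \<omega>) \<le> 1"
        using w_nonneg by simp
    qed
  qed simp
  have "(\<lambda>m. expectation (\<lambda>\<omega>. \<Sum>k<m. w k \<omega> * u ^ k)) \<longlonglongrightarrow> expectation (\<lambda>\<omega>. exp (- X \<omega> * (1 - u)))"
  proof (rule integral_dominated_convergence[where w = "\<lambda>_. 1"])
    show "AE \<omega> in M. (\<lambda>m. \<Sum>k<m. w k \<omega> * u ^ k) \<longlonglongrightarrow> exp (- X \<omega> * (1 - u))"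
      using poisson_weights_generating_function[of "X _" u] by (simp add: w_def sums_def)
    show "AE \<omega> in M. norm (\<Sum>k<m. w k \<omega> * u ^ k) \<le> 1" for m
    proof (rule AE_I2)
      fix \<omega>
      show "norm (\<Sum>k<m. w k \<omega> * u ^ k) \<le> 1"
        unfolding real_norm_def by (rule order_trans[OF sum_abs partial_sums])
    qed
  qed simp_all
  moreover have "expectation (\<lambda>\<omega>. \<Sum>k<m. w k \<omega> * u ^ k) = (\<Sum>k<m. expectation (w k) * u ^ k)" for m
    using int by simp
  ultimately have "(\<lambda>k. expectation (w k) * u ^ k) sums expectation (\<lambda>\<omega>. exp (- X \<omega> * (1 - u)))"
    unfolding sums_def by simp
  then show ?thesis
    by (simp only: w_def[abs_def])
qed

section \<open>Sigma-algebras generated by processes\<close>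

lemma generated_events_subset_Pow: "generated_events M I X \<subseteq> Pow (space M)"
  unfolding generated_events_def by (auto dest: sigma_sets_into_sp[rotated])

lemma sigma_sets_generated_events:
  "sigma_sets (space M) (generated_events M I X) = generated_events M I X"
  unfolding generated_events_def by (rule sigma_sets_sigma_sets_eq) auto

lemma generated_events_subset:
  assumes "\<And>i A. i \<in> I \<Longrightarrow> A \<in> sets borel \<Longrightarrow> X i -` A \<inter> space M \<in> generated_events M J Y"
  shows "generated_events M I X \<subseteq> generated_events M J Y"
proof -
  have "sigma_sets (space M) {X i -` A \<inter> space M | i A. i \<in> I \<and> A \<in> sets borel}
      \<subseteq> sigma_sets (space M) (generated_events M J Y)"
    by (rule sigma_sets_mono') (use assms in auto)
  then show ?thesis
    by (simp only: generated_events_def[of M I X] sigma_sets_generated_events)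
qed

lemma sets_generated_events:
  "sets (sigma (space M) (generated_events M I X)) = generated_events M I X"
  by (simp add: sets_measure_of generated_events_subset_Pow sigma_sets_generated_events)

lemma generated_events_vimage:
  "i \<in> I \<Longrightarrow> A \<in> sets borel \<Longrightarrow> X i -` A \<inter> space M \<in> generated_events M I X"
  unfolding generated_events_def by (rule sigma_sets.Basic) auto

section \<open>Iterated compositions\<close>

text \<open>A version of \<open>\<omega> \<mapsto> Z (Y \<omega>) \<omega>\<close> that is measurable and nonnegative everywhere; the two agree
  wherever the path of \<open>Z\<close> is nonnegative and right-continuous.\<close>

definition random_subst :: "(real \<Rightarrow> 'a \<Rightarrow> real) \<Rightarrow> ('a \<Rightarrow> real) \<Rightarrow> 'a \<Rightarrow> real" where
  "random_subst Z Y \<omega> = max 0 (lim (\<lambda>m. Z (upper_approx m (Y \<omega>)) \<omega>))"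

lemma measurable_random_subst:
  assumes "Y \<in> borel_measurable M" "\<And>u. 0 \<le> u \<Longrightarrow> Z u \<in> borel_measurable M"
  shows "random_subst Z Y \<in> borel_measurable M"
proof -
  have [measurable]: "(\<lambda>\<omega>. Z (upper_approx m (Y \<omega>)) \<omega>) \<in> borel_measurable M" for m
    using assms by (rule measurable_process_upper_approx)
  show ?thesis
    unfolding random_subst_def[abs_def] by measurable
qed

text \<open>\<open>tail_composition D n t j\<close> is a version of \<open>D\<^bsub>n-j+1\<^esub> (\<dots> (D\<^sub>n t))\<close>; being built from the inside, it only
  involves processes independent of the next one to be applied.\<close>

primrec tail_composition :: "(nat \<Rightarrow> real \<Rightarrow> 'a \<Rightarrow> real) \<Rightarrow> nat \<Rightarrow> real \<Rightarrow> nat \<Rightarrow> 'a \<Rightarrow> real" where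
  "tail_composition D n t 0 = (\<lambda>_. t)"
| "tail_composition D n t (Suc j) = random_subst (D (n - j)) (tail_composition D n t j)"

text \<open>A monotone path started at 0 is nonnegative. The quantifier over \<open>u\<close> stands
  inside the almost sure statement, so that one null set serves all times and a random time may be
  inserted.\<close>

lemma AE_subordinator:
  assumes "subordinator M X"
  shows "AE \<omega> in M. \<forall>u\<ge>0. 0 \<le> X u \<omega> \<and> ((\<lambda>t. X t \<omega>) \<longlongrightarrow> X u \<omega>) (at_right u)"
proof -
  have "AE \<omega> in M. X 0 \<omega> = 0" "AE \<omega> in M. cadlag_path (\<lambda>t. X t \<omega>)" "AE \<omega> in M. mono_on {0..} (\<lambda>t. X t \<omega>)"
    using assms by (auto simp: subordinator_def levy_process_def)
  then show ?thesis
  proof eventually_elim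
    case (elim \<omega>)
    show ?case
    proof (intro allI impI)
      fix u :: real
      assume "0 \<le> u"
      then show "0 \<le> X u \<omega> \<and> ((\<lambda>t. X t \<omega>) \<longlongrightarrow> X u \<omega>) (at_right u)"
        using elim(1,2) mono_onD[OF elim(3), of 0 u] by (simp add: cadlag_path_def)
    qed
  qed
qed

section \<open>Successive independent time changes and their Laplace transforms\<close>

locale independent_half_stable_subordinators = prob_space M for M :: "'a measure" +
  fixes D :: "nat \<Rightarrow> real \<Rightarrow> 'a \<Rightarrow> real" and n :: nat
  assumes subordinators: "i \<in> {1..n} \<Longrightarrow> subordinator M (D i)"
    and laplace: "i \<in> {1..n} \<Longrightarrow> 0 \<le> s \<Longrightarrow> 0 \<le> u \<Longrightarrow>
      expectation (\<lambda>\<omega>. exp (- s * D i u \<omega>)) = exp (- u * s powr (1/2))"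
    and independent: "independent_processes M {1..n} D"
begin

definition history :: "nat set \<Rightarrow> 'a measure" where
  "history J = sigma (space M) (\<Union>i\<in>J. generated_events M {0..} (D i))"

lemma space_history [simp]: "space (history J) = space M"
  by (simp add: history_def space_measure_of_conv)

lemma sets_history: "sets (history J) = sigma_sets (space M) (\<Union>i\<in>J. generated_events M {0..} (D i))"
  unfolding history_def by (intro sets_measure_of UN_least generated_events_subset_Pow)

lemma measurable_history_process:
  assumes "i \<in> J" "0 \<le> u"
  shows "D i u \<in> borel_measurable (history J)"
proof (rule measurableI)
  fix A :: "real set"
  assume "A \<in> sets borel"
  then have "D i u -` A \<inter> space M \<in> generated_events M {0..} (D i)"
    using assms by (intro generated_events_vimage) auto
  then show "D i u -` A \<inter> space (history J) \<in> sets (history J)"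
    using assms unfolding sets_history space_history by (intro sigma_sets.Basic) auto
qed simp

lemma history_mono: "I \<subseteq> J \<Longrightarrow> sets (history I) \<subseteq> sets (history J)"
  unfolding sets_history by (intro sigma_sets_mono') auto

text \<open>Independence survives grouping into disjoint blocks, because each generating family is a
  sigma-algebra and hence stable under intersection.\<close>

lemma indep_histories:
  assumes "I \<union> J \<subseteq> {1..n}" "I \<inter> J = {}"
  shows "indep_set (sets (history I)) (sets (history J))"
proof -
  have "indep_sets (\<lambda>b. sigma_sets (space M) (\<Union>i\<in>case_bool I J b. generated_events M {0..} (D i))) UNIV"
  proof (rule indep_sets_collect_sigma)
    have "(\<Union>b. case_bool I J b) = I \<union> J"
      by (simp add: UNIV_bool Un_commute)
    then show "indep_sets (\<lambda>i. generated_events M {0..} (D i)) (\<Union>b. case_bool I J b)"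
      using independent assms(1) unfolding independent_processes_def
      by (auto intro: indep_sets_mono_index)
    show "Int_stable (generated_events M {0..} (D i))" for i
      using sets.Int_stable[of "sigma (space M) (generated_events M {0..} (D i))"]
      by (simp add: sets_generated_events)
    show "disjoint_family_on (case_bool I J) UNIV"
      using assms(2) by (auto simp: disjoint_family_on_def split: bool.splits)
  qed
  also have "(\<lambda>b. sigma_sets (space M) (\<Union>i\<in>case_bool I J b. generated_events M {0..} (D i)))
      = case_bool (sets (history I)) (sets (history J))"
    by (auto simp: sets_history split: bool.splits)
  finally show ?thesis
    by (simp add: indep_set_def)
qed

lemma sets_history_subset:
  assumes "J \<subseteq> {1..n}"
  shows "sets (history J) \<subseteq> events"
  \<comment> \<open>Independence of two families includes that both consist of events; pairing with
    the empty block extracts this.\<close>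
  using indep_histories[of J "{}"] assms
  by (auto simp: indep_set_def indep_sets_def split: bool.splits)

lemma tail_composition_nonneg: "0 \<le> t \<Longrightarrow> 0 \<le> tail_composition D n t j \<omega>"
  by (cases j) (auto simp: random_subst_def)

lemma measurable_tail_composition:
  "j \<le> n \<Longrightarrow> tail_composition D n t j \<in> borel_measurable (history {n - j<..n})"
proof (induction j)
  case 0
  show ?case
    by simp
next
  case (Suc j)
  have "tail_composition D n t j \<in> borel_measurable (history {n - j<..n})"
    using Suc.prems by (intro Suc.IH) simp
  moreover have "sets (history {n - j<..n}) \<subseteq> sets (history {n - Suc j<..n})"
    by (intro history_mono) auto
  ultimately have "tail_composition D n t j \<in> borel_measurable (history {n - Suc j<..n})"
    by (rule measurable_mono_sets) simp
  moreover have "D (n - j) u \<in> borel_measurable (history {n - Suc j<..n})" if "0 \<le> u" for u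
    using Suc.prems that by (intro measurable_history_process) auto
  ultimately show ?case
    unfolding tail_composition.simps by (rule measurable_random_subst)
qed

text \<open>After \<open>j\<close> steps only processes with index above \<open>n - j\<close> have
  been used, so the next one, with index \<open>n - j\<close>, belongs to a disjoint block.\<close>

lemma indep_var_tail_composition:
  assumes "j < n" "0 \<le> u"
  shows "indep_var borel (D (n - j) u) borel (tail_composition D n t j)"
proof (rule indep_varI_subalgebras)
  show "indep_set (sets (history {n - j})) (sets (history {n - j<..n}))"
    using assms by (intro indep_histories) auto
  show "D (n - j) u \<in> borel_measurable (history {n - j})"
    using assms by (intro measurable_history_process) auto
  show "tail_composition D n t j \<in> borel_measurable (history {n - j<..n})"
    using assms by (intro measurable_tail_composition) auto
qed simp_all

lemma AE_tail_composition_Suc: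
  assumes "j < n" "0 \<le> t"
  defines "Y \<equiv> tail_composition D n t j"
  shows "AE \<omega> in M. (\<lambda>m. D (n - j) (upper_approx m (Y \<omega>)) \<omega>) \<longlonglongrightarrow> tail_composition D n t (Suc j) \<omega> \<and>
     tail_composition D n t (Suc j) \<omega> = D (n - j) (Y \<omega>) \<omega>"
proof -
  have "subordinator M (D (n - j))"
    using assms(1) by (intro subordinators) auto
  from AE_subordinator[OF this] show ?thesis
  proof eventually_elim
    case (elim \<omega>)
    have Y: "0 \<le> Y \<omega>"
      unfolding Y_def using assms(2) by (rule tail_composition_nonneg)
    have lim: "(\<lambda>m. D (n - j) (upper_approx m (Y \<omega>)) \<omega>) \<longlonglongrightarrow> D (n - j) (Y \<omega>) \<omega>"
      by (rule filterlim_compose[OF _ filterlim_upper_approx[OF Y]]) (use elim Y in blast)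
    have "tail_composition D n t (Suc j) \<omega> = max 0 (D (n - j) (Y \<omega>) \<omega>)"
      unfolding tail_composition.simps random_subst_def Y_def[symmetric] limI[OF lim] ..
    also have "\<dots> = D (n - j) (Y \<omega>) \<omega>"
      by (rule max_absorb2) (use elim Y in blast)
    finally have "tail_composition D n t (Suc j) \<omega> = D (n - j) (Y \<omega>) \<omega>" .
    then show ?case
      using lim by simp
  qed
qed

text \<open>The recursion of \<open>iterated_composition\<close> strips the innermost process, the
  one of largest index, which is the order in which \<open>tail_composition\<close> applies them.
  Each of the finitely many steps discards one null set.\<close>

lemma AE_iterated_composition_eq:
  assumes "0 \<le> t"
  shows "AE \<omega> in M. iterated_composition D n t \<omega> = tail_composition D n t n \<omega>"
proof -
  have "AE \<omega> in M. iterated_composition D n t \<omega> = iterated_composition D (n - j) (tail_composition D n t j \<omega>) \<omega>"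
    if "j \<le> n" for j
    using that
  proof (induction j)
    case (Suc j)
    then have "j < n"
      by simp
    then have split: "n - j = Suc (n - Suc j)"
      by simp
    have unfold: "iterated_composition D (n - j) x \<omega> = iterated_composition D (n - Suc j) (D (n - j) x \<omega>) \<omega>" for x \<omega>
      by (subst (1 2) split) (rule iterated_composition.simps)
    have "AE \<omega> in M. iterated_composition D n t \<omega> = iterated_composition D (n - j) (tail_composition D n t j \<omega>) \<omega>"
      using Suc by simp
    with AE_tail_composition_Suc[OF \<open>j < n\<close> assms] show ?case
    proof eventually_elim
      case (elim \<omega>)
      then show ?case
        by (simp only: unfold)
    qed
  qed simp
  from this[of n] show ?thesis
    by simp
qed

lemma measurable_tail_composition_events [measurable]:
  "j \<le> n \<Longrightarrow> tail_composition D n t j \<in> borel_measurable M"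
  using measurable_mono_sets[OF measurable_tail_composition, of j M t] sets_history_subset[of "{n - j<..n}"]
  by fastforce

text \<open>Conditioning on the inner time replaces the outer process by its Laplace transform, so
  each step trades \<open>s\<close> for its square root, and the exponents 1/2 multiply.\<close>

lemma laplace_tail_composition:
  assumes "j \<le> n" "0 \<le> t" "0 \<le> s"
  shows "expectation (\<lambda>\<omega>. exp (- s * tail_composition D n t j \<omega>)) = exp (- t * s powr (1/2) ^ j)"
  using assms(1,3)
proof (induction j arbitrary: s)
  case 0
  then show ?case
    by (simp add: prob_space mult.commute)
next
  case (Suc j)
  define V where "V = tail_composition D n t"
  have V_nonneg: "0 \<le> V i \<omega>" for i \<omega>
    unfolding V_def using assms(2) by (rule tail_composition_nonneg)
  have i: "n - j \<in> {1..n}"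
    using Suc.prems by auto
  \<comment> \<open>The function \<open>exp (- s * x)\<close> is unbounded for negative
    \<open>x\<close> when \<open>s > 0\<close>. The cut-off at 0 gives a bounded continuous
    \<open>g\<close> and changes nothing almost surely.\<close>
  have "expectation (\<lambda>\<omega>. exp (- s * max 0 (V (Suc j) \<omega>)))
      = expectation (\<lambda>\<omega>. exp (- (s powr (1/2)) * V j \<omega>))"
  proof (rule expectation_process_at_independent_time[where Z = "D (n - j)" and C = 1 and Y = "V j" and W = "V (Suc j)"
        and g = "\<lambda>x. exp (- s * max 0 x)" and h = "\<lambda>u. exp (- (s powr (1/2)) * u)"])
    show "indep_var borel (D (n - j) u) borel (V j)" if "0 \<le> u" for u
      unfolding V_def using Suc.prems that by (intro indep_var_tail_composition) auto
    show "V (Suc j) \<in> borel_measurable M"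
      unfolding V_def using Suc.prems by (intro measurable_tail_composition_events)
    show "AE \<omega> in M. (\<lambda>m. D (n - j) (upper_approx m (V j \<omega>)) \<omega>) \<longlonglongrightarrow> V (Suc j) \<omega>"
      unfolding V_def using AE_tail_composition_Suc[of j t] Suc.prems assms(2) by auto
    show "exp (- (s powr (1/2)) * u) = expectation (\<lambda>\<omega>. exp (- s * max 0 (D (n - j) u \<omega>)))"
      if "0 \<le> u" for u
    proof -
      have meas: "D (n - j) u \<in> borel_measurable M"
        using subordinators[OF i] that by (auto simp: subordinator_def levy_process_def)
      have "AE \<omega> in M. exp (- s * max 0 (D (n - j) u \<omega>)) = exp (- s * D (n - j) u \<omega>)"
        using AE_subordinator[OF subordinators[OF i]]
        by eventually_elim (use that in \<open>simp add: max_absorb2\<close>)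
      then have "expectation (\<lambda>\<omega>. exp (- s * max 0 (D (n - j) u \<omega>))) = expectation (\<lambda>\<omega>. exp (- s * D (n - j) u \<omega>))"
        using meas by (intro integral_cong_AE) simp_all
      then show ?thesis
        using laplace[OF i Suc.prems(2) that] by (simp add: mult.commute)
    qed
    show "\<bar>exp (- s * max 0 x)\<bar> \<le> 1" for x
      using Suc.prems by simp
  qed (auto intro!: continuous_intros V_nonneg)
  also have "\<dots> = exp (- t * (s powr (1/2)) powr (1/2) ^ j)"
    unfolding V_def using Suc.prems by (intro Suc.IH) auto
  finally show ?case
    using V_nonneg[of "Suc j"] by (simp add: V_def powr_powr max_absorb2 del: tail_composition.simps(2))
qed

text \<open>Given the independent time \<open>V\<close>, the count is Poisson with mean
  \<open>lam * V\<close>. The event is first replaced by a measurable one that agrees with it almost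
  surely.\<close>

lemma p_tilde_eq_mixed_poisson:
  assumes N: "poisson_process M lam N" and indep: "independent_of_processes M N {1..n} D"
    and t: "0 \<le> t"
  defines "V \<equiv> tail_composition D n t n"
  shows "p_tilde M N D n (int k) t
    = expectation (\<lambda>\<omega>. exp (- (lam * V \<omega>)) * (lam * V \<omega>) ^ k / fact k)"
proof -
  define Z where "Z u \<omega> = real (N u \<omega>)" for u \<omega>
  define W where "W \<omega> = lim (\<lambda>m. Z (upper_approx m (V \<omega>)) \<omega>)" for \<omega>
  \<comment> \<open>continuous, but the indicator of \<open>k\<close> on the integer values that \<open>N\<close> takes\<close>
  define g where "g x = max 0 (1 - \<bar>x - real k\<bar>)" for x
  have V_nonneg: "0 \<le> V \<omega>" for \<omega>
    unfolding V_def using t by (rule tail_composition_nonneg)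
  have V [measurable]: "V \<in> borel_measurable M"
    unfolding V_def by simp
  have Z: "Z u \<in> borel_measurable M" if "0 \<le> u" for u
    using N that by (auto simp: poisson_process_def levy_process_def Z_def[abs_def])
  have [measurable]: "(\<lambda>\<omega>. Z (upper_approx m (V \<omega>)) \<omega>) \<in> borel_measurable M" for m
    by (rule measurable_process_upper_approx[OF V Z])
  have W [measurable]: "W \<in> borel_measurable M"
    unfolding W_def[abs_def] by measurable
  have "AE \<omega> in M. cadlag_path (\<lambda>t. Z t \<omega>)"
    using N by (simp add: poisson_process_def levy_process_def Z_def)
  then have lim: "AE \<omega> in M. (\<lambda>m. Z (upper_approx m (V \<omega>)) \<omega>) \<longlonglongrightarrow> Z (V \<omega>) \<omega>"
  proof eventually_elim
    case (elim \<omega>)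
    then have "((\<lambda>t. Z t \<omega>) \<longlongrightarrow> Z (V \<omega>) \<omega>) (at_right (V \<omega>))"
      using V_nonneg by (simp add: cadlag_path_def)
    then show ?case
      using filterlim_upper_approx[OF V_nonneg] by (rule filterlim_compose)
  qed
  then have W_eq: "AE \<omega> in M. W \<omega> = Z (V \<omega>) \<omega>"
    by eventually_elim (simp add: W_def limI)
  \<comment> \<open>\<open>S\<close> is an event of \<open>M\<close>, while \<open>A\<close> may lie
    only in the completion; they differ by a null set and so have equal measure there.\<close>
  define S where "S = {\<omega> \<in> space M. W \<omega> = real k}"
  have S [measurable]: "S \<in> sets M"
    unfolding S_def by measurable
  define A where "A = {\<omega> \<in> space M. N (iterated_composition D n t \<omega>) \<omega> = k}"
  have "AE \<omega> in M. \<omega> \<in> S \<longleftrightarrow> \<omega> \<in> A"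
    using W_eq AE_iterated_composition_eq[OF t]
    by eventually_elim (simp add: S_def A_def Z_def V_def)
  then have AE: "AE \<omega> in completion M. \<omega> \<in> S \<longleftrightarrow> \<omega> \<in> A"
    by (rule AE_completion)
  have "A \<in> sets (completion M)"
    by (rule completion.in_sets_AE[OF AE]) (auto simp: A_def)
  then have "measure (completion M) A = measure (completion M) S"
    using AE by (intro measure_eq_AE) auto
  then have "p_tilde M N D n (int k) t = prob S"
    by (simp add: p_tilde_def A_def)
  also have "\<dots> = expectation (\<lambda>\<omega>. g (W \<omega>))"
  proof -
    have "AE \<omega> in M. g (W \<omega>) = indicator S \<omega>"
      using W_eq AE_space
    proof eventually_elim
      case (elim \<omega>)
      then show ?case
        by (cases "N (V \<omega>) \<omega>" k rule: linorder_cases) (auto simp: S_def g_def Z_def)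
    qed
    then have "expectation (\<lambda>\<omega>. g (W \<omega>)) = expectation (indicator S)"
      by (intro integral_cong_AE) (auto simp: g_def[abs_def])
    then show ?thesis
      by simp
  qed
  also have "\<dots> = expectation (\<lambda>\<omega>. exp (- (lam * V \<omega>)) * (lam * V \<omega>) ^ k / fact k)"
  proof (rule expectation_process_at_independent_time[where Z = Z and C = 1 and Y = V and W = W and g = g
        and h = "\<lambda>u. exp (- (lam * u)) * (lam * u) ^ k / fact k"])
    show "indep_var borel (Z u) borel V" if "0 \<le> u" for u
    proof (rule indep_varI_subalgebras)
      \<comment> \<open>\<open>V\<close> depends on all the processes at once, so the independence
        of \<open>N\<close> from their joint sigma-algebra \<open>?G\<close> is used.\<close>
      let ?G = "generated_events M ({1..n} \<times> {0..}) (\<lambda>(j, t). D j t)"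
      have "generated_events M {0..} (D i) \<subseteq> ?G" if "i \<in> {1..n}" for i
      proof (rule generated_events_subset)
        fix A :: "real set" and u :: real
        assume "A \<in> sets borel" "u \<in> {0..}"
        then show "D i u -` A \<inter> space M \<in> generated_events M ({1..n} \<times> {0..}) (\<lambda>(j, t). D j t)"
          using generated_events_vimage[of "(i, u)" "{1..n} \<times> {0..}" A "\<lambda>(j, t). D j t" M] that by simp
      qed
      then have "sets (history {1..n}) \<subseteq> ?G"
        unfolding sets_history
        by (subst sigma_sets_generated_events[of M "{1..n} \<times> {0..}" "\<lambda>(j, t). D j t", symmetric])
          (intro sigma_sets_mono' UN_least)
      then show "indep_set (sets (sigma (space M) (generated_events M {0..} N))) (sets (history {1..n}))"
        using indep unfolding independent_of_processes_def indep_set_def sets_generated_events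
        by (elim indep_sets_mono_sets) (auto split: bool.splits)
      have "{n - n<..n} = {1..n}"
        by auto
      then show "V \<in> borel_measurable (history {1..n})"
        unfolding V_def using measurable_tail_composition[of n t] by simp
      have "N u \<in> measurable (sigma (space M) (generated_events M {0..} N)) borel"
        using that by (intro measurableI)
          (auto simp: sets_generated_events space_measure_of_conv intro!: generated_events_vimage)
      then show "Z u \<in> borel_measurable (sigma (space M) (generated_events M {0..} N))"
        unfolding Z_def[abs_def] by (rule measurable_compose[OF _ measurable_real_nat_borel])
      show "space (sigma (space M) (generated_events M {0..} N)) = space M"
        by (simp add: space_measure_of_conv)
      show "space (history {1..n}) = space M"
        by (rule space_history)
    qed
    show "AE \<omega> in M. (\<lambda>m. Z (upper_approx m (V \<omega>)) \<omega>) \<longlonglongrightarrow> W \<omega>"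
      using lim W_eq by eventually_elim simp
    show "exp (- (lam * u)) * (lam * u) ^ k / fact k = expectation (\<lambda>\<omega>. g (Z u \<omega>))" if "0 \<le> u" for u
    proof -
      have "g (Z u \<omega>) = indicator {\<omega> \<in> space M. N u \<omega> = k} \<omega>" if "\<omega> \<in> space M" for \<omega>
        using that by (cases "N u \<omega>" k rule: linorder_cases) (auto simp: g_def Z_def)
      then have "expectation (\<lambda>\<omega>. g (Z u \<omega>)) = expectation (indicator {\<omega> \<in> space M. N u \<omega> = k})"
        by (intro Bochner_Integration.integral_cong) auto
      also have "\<dots> = prob {\<omega> \<in> space M. N u \<omega> = k}"
        by (simp add: Int_absorb2 subset_iff)
      also have "\<dots> = exp (- lam * u) * (lam * u) ^ k / fact k"
        using N that by (simp add: poisson_process_def)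
      finally show ?thesis
        by simp
    qed
  qed (auto simp: g_def[abs_def] W V_nonneg intro!: continuous_intros)
  finally show ?thesis .
qed

end

section \<open>The equation of order \<open>2 ^ n\<close> from the generating function\<close>

theorem proposition3p1:
  fixes M :: "'a measure"
    and lam :: real
    and n :: nat
    and D :: "nat \<Rightarrow> real \<Rightarrow> 'a \<Rightarrow> real"
    and N :: "real \<Rightarrow> 'a \<Rightarrow> nat"
    and k :: nat
    and t :: real
  assumes "prob_space M"
    and "lam > 0"
    and "n \<ge> 1"
    and "\<And>i. i \<in> {1..n} \<Longrightarrow> stable_subordinator M (1/2) (D i)"
    and "\<And>i s u. i \<in> {1..n} \<Longrightarrow> s \<ge> 0 \<Longrightarrow> u \<ge> 0 \<Longrightarrow>
           prob_space.expectation M (\<lambda>\<omega>. exp (- s * D i u \<omega>)) = exp (- u * s powr (1/2))"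
    and "independent_processes M {1..n} D"
    and "poisson_process M lam N"
    and "independent_of_processes M N {1..n} D"
    and "t > 0"
  shows "(\<forall>m < 2 ^ n. (deriv ^^ m) (p_tilde M N D n (int k)) differentiable (at t)) \<and>
         (deriv ^^ (2 ^ n)) (p_tilde M N D n (int k)) t
           = lam * (p_tilde M N D n (int k) t - p_tilde M N D n (int k - 1) t)"
proof -
  interpret prob_space M
    by fact
  interpret independent_half_stable_subordinators M D n
    using assms by unfold_locales (auto simp: stable_subordinator_def)
  define \<alpha> :: real where "\<alpha> = (1/2) ^ n"
  define a where "a u = lam powr \<alpha> * (1 - u) powr \<alpha>" for u
  define A where "A = Abs_fps (\<lambda>n. lam powr \<alpha> * ((\<alpha> gchoose n) * (- 1) ^ n))"
  define p where "p k = p_tilde M N D n (int k)" for k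
  have A: "a has_fps_expansion A"
    unfolding a_def A_def by (rule has_fps_expansion_powr_one_minus)
  have near_0: "\<forall>\<^sub>F u :: real in nhds 0. \<bar>u\<bar> < 1"
    using eventually_nhds_in_open[of "ball 0 1" "0 :: real"] by (simp add: dist_real_def)
  have P: "(\<lambda>u. exp (- s * a u)) has_fps_expansion Abs_fps (\<lambda>k. p k s)" if "s > 0" for s
  proof (rule has_fps_expansionI)
    define V where "V = tail_composition D n s n"
    have V: "V \<in> borel_measurable M" "0 \<le> V \<omega>" for \<omega>
      using that by (auto simp: V_def tail_composition_nonneg)
    show "\<forall>\<^sub>F u in nhds 0. (\<lambda>k. fps_nth (Abs_fps (\<lambda>k. p k s)) k * u ^ k) sums exp (- s * a u)"
      using near_0
    proof eventually_elim
      case (elim u)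
      have "(\<lambda>k. expectation (\<lambda>\<omega>. exp (- (lam * V \<omega>)) * (lam * V \<omega>) ^ k / fact k) * u ^ k)
          sums expectation (\<lambda>\<omega>. exp (- (lam * V \<omega>) * (1 - u)))"
        using V \<open>lam > 0\<close> elim by (intro mixed_poisson_generating_function) auto
      moreover have "p k s = expectation (\<lambda>\<omega>. exp (- (lam * V \<omega>)) * (lam * V \<omega>) ^ k / fact k)" for k
        unfolding p_def V_def using assms that by (intro p_tilde_eq_mixed_poisson) auto
      \<comment> \<open>The Laplace transform of \<open>V\<close> at \<open>lam * (1 - u)\<close>,
        which is positive because \<bar>u\<bar> < 1.\<close>
      moreover have "expectation (\<lambda>\<omega>. exp (- (lam * V \<omega>) * (1 - u))) = exp (- s * a u)"
        using laplace_tail_composition[of n s "lam * (1 - u)"] that elim \<open>lam > 0\<close>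
        by (simp add: V_def a_def \<alpha>_def powr_mult mult_ac)
      ultimately show ?case
        by simp
    qed
  qed
  \<comment> \<open>For \<open>u\<close> near 0 the base \<open>lam * (1 - u)\<close> is positive,
    so the exponents combine to \<alpha> times \<open>2 ^ n\<close>, which is 1; uniqueness carries
    this over to the series.\<close>
  have A_power: "A ^ 2 ^ n = fps_const lam * (1 - fps_X)"
  proof (rule has_fps_expansion_unique)
    have "(\<lambda>u. a u ^ m) has_fps_expansion A ^ m" for m
      by (induction m) (auto intro!: fps_expansion_intros A)
    then show "(\<lambda>u. a u ^ 2 ^ n) has_fps_expansion A ^ 2 ^ n" .
    have "(\<lambda>u. lam * (1 - u)) has_fps_expansion fps_const lam * (1 - fps_X)"
      by (intro fps_expansion_intros)
    moreover have "\<forall>\<^sub>F u in nhds 0. lam * (1 - u) = a u ^ 2 ^ n"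
      using near_0
    proof eventually_elim
      case (elim u)
      have "a u ^ 2 ^ n = (lam * (1 - u)) powr (\<alpha> * 2 ^ n)"
        using elim \<open>lam > 0\<close> by (simp add: a_def powr_mult powr_power power_mult_distrib mult.commute)
      also have "\<alpha> * 2 ^ n = 1"
        by (simp add: \<alpha>_def flip: power_mult_distrib)
      finally show ?case
        using elim \<open>lam > 0\<close> by simp
    qed
    ultimately show "(\<lambda>u. a u ^ 2 ^ n) has_fps_expansion fps_const lam * (1 - fps_X)"
      unfolding has_fps_expansion_def by (auto elim: eventually_elim2)
  qed
  have "(deriv ^^ m) (p k) differentiable (at t)" for m
    using exponential_family_coeff_iterated_deriv(2)[OF A P \<open>t > 0\<close>]
    by (auto simp: real_differentiable_def)
  moreover have "(deriv ^^ (2 ^ n)) (p k) t = lam * (p k t - p_tilde M N D n (int k - 1) t)"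
  proof -
    have "(deriv ^^ (2 ^ n)) (p k) t = fps_nth ((- A) ^ 2 ^ n * Abs_fps (\<lambda>k. p k t)) k"
      by (rule exponential_family_coeff_iterated_deriv(1)[OF A P \<open>t > 0\<close>])
    \<comment> \<open>The sign disappears since \<open>2 ^ n\<close> is even for
      \<open>n \<ge> 1\<close>.\<close>
    also have "(- A) ^ 2 ^ n = fps_const lam * (1 - fps_X)"
      using A_power \<open>n \<ge> 1\<close> by (subst power_minus_even) auto
    \<comment> \<open>Multiplication by \<open>fps_X\<close> shifts the index by one; at
      \<open>k = 0\<close> the missing coefficient matches the value 0 of \<open>p_tilde\<close> at
      index -1.\<close>
    also have "fps_nth (fps_const lam * (1 - fps_X) * Abs_fps (\<lambda>k. p k t)) k
        = lam * (p k t - (if k = 0 then 0 else p (k - 1) t))"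
      by (simp add: mult.assoc left_diff_distrib)
    also have "(if k = 0 then 0 else p (k - 1) t) = p_tilde M N D n (int k - 1) t"
      by (auto simp: p_def p_tilde_def nat_diff_distrib)
    finally show ?thesis .
  qed
  ultimately show ?thesis
    by (simp add: p_def)
qed

end
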